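(* Let $\alpha,\beta,\gamma,a,b,c,z\in\mathbb{C}$ and $p\ge 0$ with $\mathrm{Re}(\alpha)>0$, $\mathrm{Re}(c)>\mathrm{Re}(b)>0$ and $|\arg(1-z)|<\pi$. Then $${}^{ML}F_{p}(a,b;c;z)=(1-z)^{-a}\;{}^{ML}F_{p}\left(a,c-b;b;\frac{z}{z-1}\right).$$
   Context: The three-parameter Mittag-Leffler function is $E_{\alpha,\beta}^{\gamma}(z)=\sum_{n=0}^{\infty}\frac{(\gamma)_n}{\Gamma(\alpha n+\beta)}\frac{z^n}{n!}$ for $\alpha,\beta,\gamma\in\mathbb{C}$, $\mathrm{Re}(\alpha)>0$, where $(\gamma)_n=\gamma(\gamma+1)\cdots(\gamma+n-1)$, $(\gamma)_0=1$. The ML-generalized beta function is ${}^{ML}B_{p}(x,y)=\int_{0}^{1}t^{x-1}(1-t)^{y-1}E_{\alpha,\beta}^{\gamma}\left(-\frac{p}{t(1-t)}\right)dt$ for $\mathrm{Re}(x)>0$, $\mathrm{Re}(y)>0$ (the parameters $\alpha,\beta,\gamma$ are suppressed in the notation), and $B(x,y)=\int_0^1 t^{x-1}(1-t)^{y-1}dt$ is the classical beta function. The ML-generalized Gauss hypergeometric function, with parameters listed in the order $(a,b;c;z)$, is ${}^{ML}F_{p}(a,b;c;z)=\sum_{n=0}^{\infty}(a)_n\frac{{}^{ML}B_{p}(b+n,c-b)}{B(b,c-b)}\frac{z^n}{n!}$ for $p\ge 0$, $|z|<1$, $\mathrm{Re}(c)>\mathrm{Re}(b)>0$, $\mathrm{Re}(\alpha)>0$;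 it is also represented, for $p>0$, or $p=0$ and $|\arg(1-z)|<\pi$, by the integral $\frac{1}{B(b,c-b)}\int_{0}^{1}t^{b-1}(1-t)^{c-b-1}(1-zt)^{-a}E_{\alpha,\beta}^{\gamma}\left(-\frac{p}{t(1-t)}\right)dt$.
   Formalization: The third parameter of F_p on the right is c instead of the printed b (the printed identity fails, e.g. p=0, α=β=γ=1, a=-1, b=2, c=3), and for p>0 the integral defining B_p(b,c-b) is assumed to converge, as it need not under the stated conditions. *)

theory Defs
  imports "HOL-Analysis.Analysis"
begin

text \<open>
  The factor \<^term>\<open>rGamma\<close> is the entire function \<open>1/\<Gamma>\<close>, so a term with \<open>\<alpha> n + \<beta>\<close> at a pole of
  \<open>\<Gamma>\<close> is zero, as usual. The series converges everywhere when \<open>Re \<alpha> > 0\<close>.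
\<close>
definition mittag_leffler3 :: "complex \<Rightarrow> complex \<Rightarrow> complex \<Rightarrow> complex \<Rightarrow> complex" where
  "mittag_leffler3 \<alpha> \<beta> \<gamma> z =
     (\<Sum>n. pochhammer \<gamma> n * rGamma (\<alpha> * of_nat n + \<beta>) * z ^ n / fact n)"

definition ml_beta_integrand ::
  "complex \<Rightarrow> complex \<Rightarrow> complex \<Rightarrow> real \<Rightarrow> complex \<Rightarrow> complex \<Rightarrow> real \<Rightarrow> complex" where
  "ml_beta_integrand \<alpha> \<beta> \<gamma> p x y t =
     of_real t powr (x - 1) * of_real (1 - t) powr (y - 1) *
     mittag_leffler3 \<alpha> \<beta> \<gamma> (of_real (- p / (t * (1 - t))))"

text \<open>
  Integrals are Henstock-Kurzweil integrals, which include the (possibly only conditionally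
  convergent) improper Riemann integrals at the endpoints; the value of the integrand at \<open>0\<close> and
  \<open>1\<close> is irrelevant. For \<open>p > 0\<close> convergence does not follow from \<open>Re \<alpha>, Re x, Re y > 0\<close>: with
  \<open>\<alpha> = \<beta> = 1\<close>, \<open>\<gamma> = -1\<close> the Mittag-Leffler factor is \<open>1 + p / (t (1 - t))\<close>, and the integral
  converges only if \<open>Re x, Re y > 1\<close>.
\<close>
definition ml_beta ::
  "complex \<Rightarrow> complex \<Rightarrow> complex \<Rightarrow> real \<Rightarrow> complex \<Rightarrow> complex \<Rightarrow> complex" where
  "ml_beta \<alpha> \<beta> \<gamma> p x y = integral {0..1} (ml_beta_integrand \<alpha> \<beta> \<gamma> p x y)"

text \<open>
  The power series on the unit disc; off the disc, the Euler-type integral that continues it to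
  the plane cut along \<open>[1, \<infinity>)\<close>. The parameters after \<open>p\<close> are in the order \<open>(a, b; c; z)\<close>, and
  \<^term>\<open>Beta\<close> is the classical beta function.
\<close>
definition ml_hypergeom ::
  "complex \<Rightarrow> complex \<Rightarrow> complex \<Rightarrow> real \<Rightarrow> complex \<Rightarrow> complex \<Rightarrow> complex \<Rightarrow> complex \<Rightarrow> complex" where
  "ml_hypergeom \<alpha> \<beta> \<gamma> p a b c z =
     (if norm z < 1
      then (\<Sum>n. pochhammer a n * (ml_beta \<alpha> \<beta> \<gamma> p (b + of_nat n) (c - b) / Beta b (c - b))
                  * z ^ n / fact n)
      else 1 / Beta b (c - b) *
           integral {0..1} (\<lambda>t. ml_beta_integrand \<alpha> \<beta> \<gamma> p b (c - b) t
                                 * (1 - z * of_real t) powr (- a)))"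

end

theory Submission
  imports Defs
begin

text \<open>
  On the unit disc the hypergeometric series equals the Euler-type integral, so both sides of the
  identity are integrals, and the substitution \<open>t \<mapsto> 1 - t\<close> carries one to the other, because
  \<open>1 - w (1 - s) = (1 - z s) / (1 - z)\<close> for \<open>w = z / (z - 1)\<close> and the principal powers split
  accordingly: \<open>1 - z s\<close> lies on the segment from \<open>1\<close> to \<open>1 - z\<close>.

  The integrand may be only conditionally integrable, so dominated convergence cannot justify
  integrating the binomial series term by term. Instead, the second mean value theorem bounds the
  integral of \<open>g f\<close> by \<open>C g(1)\<close> for every nonnegative increasing weight \<open>g\<close>, with \<open>C\<close>
  depending only on \<open>f\<close>; the tails of a power series with nonnegative summable coefficients are
  such weights and tend to \<open>0\<close> at \<open>1\<close>. Complex coefficients are combinations of four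
  nonnegative sequences.
\<close>

section \<open>Integrals against nonnegative increasing weights\<close>

lemma monotone_weight_bound_real:
  fixes f :: "real \<Rightarrow> real"
  assumes f: "f integrable_on {0..1}"
  shows "\<exists>C\<ge>0. \<forall>g. mono_on {0..1} g \<longrightarrow> 0 \<le> g 0 \<longrightarrow>
           (\<lambda>t. g t * f t) integrable_on {0..1} \<and> \<bar>integral {0..1} (\<lambda>t. g t * f t)\<bar> \<le> C * g 1"
proof -
  have c1: "continuous_on {0..1} (\<lambda>x. integral {0..x} f)"
    by (rule indefinite_integral_continuous_1[OF f])
  have c2: "continuous_on {0..1} (\<lambda>x. integral {x..1} f)"
    by (rule indefinite_integral_continuous_1'[OF f])
  \<comment> \<open>The cut point given by the mean value theorem depends on the weight, so both
    primitives are bounded over all of [0,1]; this makes the final constant independent of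
    \<open>g\<close>.\<close>
  obtain A where A: "\<And>x. x \<in> {0..1} \<Longrightarrow> \<bar>integral {0..x} f\<bar> \<le> A"
    using compact_imp_bounded[OF compact_continuous_image[OF c1 compact_Icc]]
    unfolding bounded_iff by (metis imageI real_norm_def)
  obtain B where B: "\<And>x. x \<in> {0..1} \<Longrightarrow> \<bar>integral {x..1} f\<bar> \<le> B"
    using compact_imp_bounded[OF compact_continuous_image[OF c2 compact_Icc]]
    unfolding bounded_iff by (metis imageI real_norm_def)
  have A0: "0 \<le> A" and B0: "0 \<le> B" using A[of 0] B[of 0] by auto
  show ?thesis
  proof (intro exI[of _ "A + B"] conjI allI impI)
    show "0 \<le> A + B" using A0 B0 by simp
    fix g :: "real \<Rightarrow> real" assume g: "mono_on {0..1} g" and g0: "0 \<le> g 0"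
    have mono: "g x \<le> g y" if "0 \<le> x" "x \<le> y" "y \<le> 1" for x y
      using that g by (auto simp: mono_on_def)
    obtain c where c: "c \<in> {0..1}"
      and I: "((\<lambda>x. g x * f x) has_integral (g 0 * integral {0..c} f + g 1 * integral {c..1} f)) {0..1}"
      by (rule second_mean_value_theorem_full[OF f, of g]) (use mono in auto)
    show "(\<lambda>t. g t * f t) integrable_on {0..1}" using I by blast
    have "\<bar>integral {0..1} (\<lambda>t. g t * f t)\<bar> \<le> \<bar>g 0\<bar> * \<bar>integral {0..c} f\<bar> + \<bar>g 1\<bar> * \<bar>integral {c..1} f\<bar>"
      unfolding integral_unique[OF I] by (metis abs_mult abs_triangle_ineq)
    also have "\<dots> \<le> g 1 * A + g 1 * B"
      using mono[of 0 1] g0 A[OF c] B[OF c] by (intro add_mono mult_mono) auto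
    finally show "\<bar>integral {0..1} (\<lambda>t. g t * f t)\<bar> \<le> (A + B) * g 1" by (simp add: algebra_simps)
  qed
qed

text \<open>The second mean value theorem is a statement about real integrands. The real and
  imaginary parts may need different cut points, but their bounds simply add.\<close>

lemma monotone_weight_bound:
  fixes f :: "real \<Rightarrow> complex"
  assumes f: "f integrable_on {0..1}"
  obtains C where "C \<ge> 0"
    "\<And>g. \<lbrakk>mono_on {0..1} g; 0 \<le> g 0\<rbrakk> \<Longrightarrow> (\<lambda>t. of_real (g t) * f t) integrable_on {0..1}"
    "\<And>g. \<lbrakk>mono_on {0..1} g; 0 \<le> g 0\<rbrakk> \<Longrightarrow>
       norm (integral {0..1} (\<lambda>t. of_real (g t) * f t)) \<le> C * g 1"
proof -
  have Re: "(\<lambda>t. Re (f t)) integrable_on {0..1}" and Im: "(\<lambda>t. Im (f t)) integrable_on {0..1}"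
    using integrable_linear[OF f bounded_linear_Re] integrable_linear[OF f bounded_linear_Im]
    by (simp_all add: o_def)
  obtain A where A0: "A \<ge> 0" and A: "\<And>g. mono_on {0..1} g \<Longrightarrow> 0 \<le> g 0 \<Longrightarrow>
      (\<lambda>t. g t * Re (f t)) integrable_on {0..1} \<and>
      \<bar>integral {0..1} (\<lambda>t. g t * Re (f t))\<bar> \<le> A * g 1"
    using monotone_weight_bound_real[OF Re] by blast
  obtain B where B0: "B \<ge> 0" and B: "\<And>g. mono_on {0..1} g \<Longrightarrow> 0 \<le> g 0 \<Longrightarrow>
      (\<lambda>t. g t * Im (f t)) integrable_on {0..1} \<and>
      \<bar>integral {0..1} (\<lambda>t. g t * Im (f t))\<bar> \<le> B * g 1"
    using monotone_weight_bound_real[OF Im] by blast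
  have I: "((\<lambda>t. of_real (g t) * f t) has_integral
      (of_real (integral {0..1} (\<lambda>t. g t * Re (f t))) +
       \<i> * of_real (integral {0..1} (\<lambda>t. g t * Im (f t))))) {0..1}" (is "(_ has_integral (?a + ?b)) _")
    if g: "mono_on {0..1} g" "0 \<le> g 0" for g
  proof -
    have "((\<lambda>t. of_real (g t * Re (f t)) + \<i> * of_real (g t * Im (f t))) has_integral (?a + ?b)) {0..1}"
      using A[OF g] B[OF g]
      by (intro has_integral_add has_integral_of_real has_integral_mult_right integrable_integral) auto
    moreover have "(\<lambda>t. complex_of_real (g t * Re (f t)) + \<i> * of_real (g t * Im (f t))) =
                   (\<lambda>t. of_real (g t) * f t)"
      by (auto simp: complex_eq_iff)
    ultimately show ?thesis by simp
  qed
  show ?thesis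
  proof (rule that[of "A + B"])
    show "A + B \<ge> 0" using A0 B0 by simp
    fix g :: "real \<Rightarrow> real" assume g: "mono_on {0..1} g" "0 \<le> g 0"
    show "(\<lambda>t. of_real (g t) * f t) integrable_on {0..1}" using I[OF g] by blast
    have "norm (integral {0..1} (\<lambda>t. of_real (g t) * f t)) \<le>
        \<bar>integral {0..1} (\<lambda>t. g t * Re (f t))\<bar> + \<bar>integral {0..1} (\<lambda>t. g t * Im (f t))\<bar>"
      unfolding integral_unique[OF I[OF g]]
      by (rule order_trans[OF norm_triangle_ineq]) (simp add: norm_mult)
    also have "\<dots> \<le> (A + B) * g 1" using A[OF g] B[OF g] by (simp add: algebra_simps)
    finally show "norm (integral {0..1} (\<lambda>t. of_real (g t) * f t)) \<le> (A + B) * g 1" .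
  qed
qed

section \<open>Termwise integration of power series on [0,1]\<close>

lemma summable_mult_power_unit_interval:
  fixes c :: "nat \<Rightarrow> 'a :: {real_normed_algebra_1, banach}"
  assumes "summable (\<lambda>n. norm (c n))" "t \<in> {0..1}"
  shows "summable (\<lambda>n. c n * of_real t ^ n)"
proof (rule summable_comparison_test'[OF assms(1), of 0])
  fix n :: nat
  have "norm (c n * of_real t ^ n) \<le> norm (c n) * \<bar>t\<bar> ^ n"
    by (metis norm_mult_ineq norm_of_real of_real_power power_abs)
  also have "\<dots> \<le> norm (c n) * 1"
    using assms(2) by (intro mult_left_mono power_le_one) auto
  finally show "norm (c n * of_real t ^ n) \<le> norm (c n)" by simp
qed

lemma has_integral_power_series_mult_nonneg:
  fixes f :: "real \<Rightarrow> complex" and c :: "nat \<Rightarrow> real"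
  assumes f: "f integrable_on {0..1}" and c0: "\<And>n. c n \<ge> 0" and c: "summable c"
  shows "\<exists>I. (\<lambda>n. of_real (c n) * integral {0..1} (\<lambda>t. of_real t ^ n * f t)) sums I \<and>
             ((\<lambda>t. (\<Sum>n. of_real (c n) * of_real t ^ n) * f t) has_integral I) {0..1}"
proof -
  obtain C where C0: "C \<ge> 0"
    and int: "\<And>g. \<lbrakk>mono_on {0..1} g; 0 \<le> g 0\<rbrakk> \<Longrightarrow> (\<lambda>t. of_real (g t) * f t) integrable_on {0..1}"
    and bnd: "\<And>g. \<lbrakk>mono_on {0..1} g; 0 \<le> g 0\<rbrakk> \<Longrightarrow>
       norm (integral {0..1} (\<lambda>t. of_real (g t) * f t)) \<le> C * g 1"
    by (rule monotone_weight_bound[OF f]) blast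
  define M where "M n = integral {0..1} (\<lambda>t. of_real t ^ n * f t)" for n
  \<comment> \<open>The tail keeps its full power \<open>t ^ (n + N)\<close>, so \<open>h 0\<close>
    is the whole series, each \<open>h N\<close> is increasing, and its value at 1 is the tail of
    the coefficient sum.\<close>
  define h where "h N t = (\<Sum>n. c (n + N) * t ^ (n + N))" for N and t :: real
  have sm: "summable (\<lambda>n. c n * t ^ n)" if "t \<in> {0..1}" for t
    using summable_mult_power_unit_interval[of c t] that c c0 by simp
  have smN: "summable (\<lambda>n. c (n + N) * t ^ (n + N))" if "t \<in> {0..1}" for t N
    using sm[OF that] by (subst summable_iff_shift)
  have hmono: "mono_on {0..1} (h N)" for N
    unfolding h_def by (intro mono_onI suminf_le smN mult_left_mono power_mono c0) auto
  have h0: "0 \<le> h N 0" for N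
    unfolding h_def by (intro suminf_nonneg smN) (auto simp: c0)
  \<comment> \<open>Here \<open>t ^ n\<close> is itself an increasing weight, which supplies
    integrability even when \<open>f\<close> is not absolutely integrable.\<close>
  have pow: "((\<lambda>t. of_real t ^ n * f t) has_integral M n) {0..1}" for n
  proof -
    have "mono_on {0..1} (\<lambda>t::real. t ^ n)" by (intro mono_onI power_mono) auto
    then show ?thesis unfolding M_def using int[of "\<lambda>t. t ^ n"]
      by (intro integrable_integral) simp
  qed
  define I where "I = integral {0..1} (\<lambda>t. of_real (h 0 t) * f t)"
  have I: "((\<lambda>t. of_real (h 0 t) * f t) has_integral I) {0..1}"
    unfolding I_def by (intro integrable_integral int hmono h0)
  \<comment> \<open>The error after \<open>N\<close> terms is exactly the integral of
    \<open>h N\<close> times \<open>f\<close>, and the same \<open>C\<close> serves every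
    \<open>N\<close>.\<close>
  have tail: "norm (I - (\<Sum>n<N. of_real (c n) * M n)) \<le> C * (\<Sum>n. c (n + N))" for N
  proof -
    have int0: "((\<lambda>t. of_real (h 0 t) * f t - (\<Sum>n<N. of_real (c n) * (of_real t ^ n * f t)))
            has_integral (I - (\<Sum>n<N. of_real (c n) * M n))) {0..1}"
      by (intro has_integral_diff I has_integral_sum has_integral_mult_right pow) auto
    have eq: "of_real (h 0 t) * f t - (\<Sum>n<N. of_real (c n) * (of_real t ^ n * f t)) =
        of_real (h N t) * f t" if t: "t \<in> {0..1}" for t
    proof -
      have "h 0 t = h N t + (\<Sum>n<N. c n * t ^ n)"
        unfolding h_def using suminf_split_initial_segment[OF sm[OF t], of N] by simp
      then show ?thesis by (simp add: algebra_simps sum_distrib_left)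
    qed
    have "((\<lambda>t. of_real (h N t) * f t) has_integral
        (I - (\<Sum>n<N. of_real (c n) * M n))) {0..1}"
      by (rule has_integral_eq[OF eq int0])
    then have "I - (\<Sum>n<N. of_real (c n) * M n) = integral {0..1} (\<lambda>t. of_real (h N t) * f t)"
      by (simp add: integral_unique)
    then show ?thesis using bnd[OF hmono[of N] h0] by (simp add: h_def)
  qed
  have "(\<lambda>N. C * (\<Sum>n. c (n + N))) \<longlonglongrightarrow> 0"
    using tendsto_mult[OF tendsto_const[of C] suminf_exist_split2[OF c]] by simp
  then have "(\<lambda>N. I - (\<Sum>n<N. of_real (c n) * M n)) \<longlonglongrightarrow> 0"
    by (rule Lim_null_comparison[OF always_eventually[OF allI[OF tail]]])
  then have "(\<lambda>N. I - (I - (\<Sum>n<N. of_real (c n) * M n))) \<longlonglongrightarrow> I - 0"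
    by (intro tendsto_diff tendsto_const)
  then have "(\<lambda>n. of_real (c n) * M n) sums I" by (simp add: sums_def)
  moreover have "((\<lambda>t. (\<Sum>n. of_real (c n) * of_real t ^ n) * f t) has_integral I) {0..1}"
  proof (rule has_integral_eq[OF _ I])
    fix t :: real assume "t \<in> {0..1}"
    from suminf_of_real[OF sm[OF this], where ?'a = complex]
    show "of_real (h 0 t) * f t = (\<Sum>n. of_real (c n) * of_real t ^ n) * f t"
      by (simp add: h_def)
  qed
  ultimately show ?thesis unfolding M_def by blast
qed

lemma has_integral_power_series_mult:
  fixes f :: "real \<Rightarrow> complex" and c :: "nat \<Rightarrow> complex"
  assumes f: "f integrable_on {0..1}" and c: "summable (\<lambda>n. norm (c n))"
  shows "\<exists>I. (\<lambda>n. c n * integral {0..1} (\<lambda>t. of_real t ^ n * f t)) sums I \<and>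
             ((\<lambda>t. (\<Sum>n. c n * of_real t ^ n) * f t) has_integral I) {0..1}"
proof -
  define M where "M n = integral {0..1} (\<lambda>t. of_real t ^ n * f t)" for n
  \<comment> \<open>Absolute summability is carried along in \<open>P\<close> because the pointwise
    series must be split when sequences are combined.\<close>
  define P where "P c \<longleftrightarrow> summable (\<lambda>n. norm (c n)) \<and> (\<exists>I. (\<lambda>n. c n * M n) sums I \<and>
             ((\<lambda>t. (\<Sum>n. c n * of_real t ^ n) * f t) has_integral I) {0..1})" for c
  \<comment> \<open>One closure property serves both decompositions: \<open>k = 1\<close> for
    positive minus negative part, \<open>k = -\<i>\<close> for real plus \<open>\<i>\<close> times
    imaginary part.\<close>
  have diff: "P (\<lambda>n. u n - k * v n)" if u: "P u" and v: "P v" for u v k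
  proof -
    from u obtain I where su: "summable (\<lambda>n. norm (u n))" and I: "(\<lambda>n. u n * M n) sums I"
      "((\<lambda>t. (\<Sum>n. u n * of_real t ^ n) * f t) has_integral I) {0..1}" by (auto simp: P_def)
    from v obtain J where sv: "summable (\<lambda>n. norm (v n))" and J: "(\<lambda>n. v n * M n) sums J"
      "((\<lambda>t. (\<Sum>n. v n * of_real t ^ n) * f t) has_integral J) {0..1}" by (auto simp: P_def)
    have "summable (\<lambda>n. norm (u n) + norm k * norm (v n))"
      by (intro summable_add summable_mult su sv)
    then have "summable (\<lambda>n. norm (u n - k * v n))"
    proof (rule summable_comparison_test'[of _ 0])
      show "norm (norm (u n - k * v n)) \<le> norm (u n) + norm k * norm (v n)" for n
        using norm_triangle_ineq4[of "u n" "k * v n"] by (simp add: norm_mult)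
    qed
    moreover have "(\<lambda>n. (u n - k * v n) * M n) sums (I - k * J)"
      using sums_diff[OF I(1) sums_mult[OF J(1), of k]] by (simp add: algebra_simps)
    moreover have "((\<lambda>t. (\<Sum>n. (u n - k * v n) * of_real t ^ n) * f t) has_integral (I - k * J)) {0..1}"
    proof (rule has_integral_eq[OF _ has_integral_diff[OF I(2) has_integral_mult_right[OF J(2), of k]]])
      fix t :: real assume t: "t \<in> {0..1}"
      note s = summable_mult_power_unit_interval[OF su t] summable_mult_power_unit_interval[OF sv t]
      have "(\<Sum>n. (u n - k * v n) * of_real t ^ n) =
          (\<Sum>n. u n * of_real t ^ n) - k * (\<Sum>n. v n * of_real t ^ n)"
        unfolding suminf_mult[OF s(2), symmetric] suminf_diff[OF s(1) summable_mult[OF s(2)]]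
        by (simp add: left_diff_distrib mult.assoc)
      then show "(\<Sum>n. u n * of_real t ^ n) * f t - k * ((\<Sum>n. v n * of_real t ^ n) * f t) =
          (\<Sum>n. (u n - k * v n) * of_real t ^ n) * f t"
        by (simp only: left_diff_distrib[of _ _ "f t"] mult.assoc)
    qed
    ultimately show ?thesis unfolding P_def by blast
  qed
  have nonneg: "P (\<lambda>n. of_real (r n))" if "\<And>n. 0 \<le> r n" "\<And>n. r n \<le> norm (c n)" for r
  proof -
    have "summable r" by (rule summable_comparison_test'[OF c, of 0]) (use that in auto)
    with has_integral_power_series_mult_nonneg[OF f, of r] that show ?thesis
      by (simp add: P_def M_def)
  qed
  have real: "P (\<lambda>n. of_real (r n))" if "\<And>n. \<bar>r n\<bar> \<le> norm (c n)" for r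
  proof -
    have "P (\<lambda>n. of_real (max 0 (r n)))" "P (\<lambda>n. of_real (max 0 (- r n)))"
      using that by (auto intro!: nonneg simp: abs_le_iff)
    from diff[OF this, of 1]
    have "P (\<lambda>n. of_real (max 0 (r n) - max 0 (- r n)))" by simp
    moreover have "max 0 (r n) - max 0 (- r n) = r n" for n by (simp add: max_def)
    ultimately show ?thesis by simp
  qed
  have "P (\<lambda>n. of_real (Re (c n)) - (-\<i>) * of_real (Im (c n)))"
    by (intro diff real abs_Re_le_cmod abs_Im_le_cmod)
  moreover have "of_real (Re (c n)) - (-\<i>) * of_real (Im (c n)) = c n" for n
    by (simp add: complex_eq_iff)
  ultimately show ?thesis by (simp add: P_def M_def)
qed

section \<open>The binomial series and the Euler-type integral\<close>

lemma binomial_series_sums: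
  fixes a z :: complex
  assumes "norm z < 1"
  shows "(\<lambda>n. pochhammer a n / fact n * z ^ n) sums (1 - z) powr (- a)"
proof -
  have "((-a) gchoose n) * (- z) ^ n = pochhammer a n / fact n * z ^ n" for n
  proof -
    have "((-a) gchoose n) * (- z) ^ n = ((- 1) ^ n * (- z) ^ n) * (pochhammer a n / fact n)"
      by (simp add: gbinomial_pochhammer)
    also have "(- 1) ^ n * (- z) ^ n = z ^ n" by (simp flip: power_mult_distrib)
    finally show ?thesis by simp
  qed
  then show ?thesis using gen_binomial_complex[of "-z" "-a"] assms by simp
qed

lemma binomial_series_abs_summable:
  fixes a z :: complex
  assumes "norm z < 1"
  shows "summable (\<lambda>n. norm (pochhammer a n / fact n * z ^ n))"
proof (rule powser_insidea)
  \<comment> \<open>A real point strictly between \<open>norm z\<close> and 1: convergence there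
    forces absolute convergence at \<open>z\<close>.\<close>
  let ?x = "of_real ((1 + norm z) / 2) :: complex"
  have "norm ?x = (1 + norm z) / 2" unfolding norm_of_real by simp
  then show "norm z < norm ?x" using assms by simp
  show "summable (\<lambda>n. pochhammer a n / fact n * ?x ^ n)"
    by (rule sums_summable[OF binomial_series_sums]) (use assms in \<open>simp only: norm_of_real, simp\<close>)
qed

text \<open>A single formula for both branches of the definition is needed because \<open>z\<close>
  and \<open>z / (z - 1)\<close> can lie on different sides of the unit circle. Only the disc
  requires an argument: expand the binomial factor and integrate termwise.\<close>

lemma ml_hypergeom_eq_integral:
  assumes f: "ml_beta_integrand \<alpha> \<beta> \<gamma> p b (c - b) integrable_on {0..1}"
  shows "ml_hypergeom \<alpha> \<beta> \<gamma> p a b c z = 1 / Beta b (c - b) *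
           integral {0..1} (\<lambda>t. ml_beta_integrand \<alpha> \<beta> \<gamma> p b (c - b) t
                                 * (1 - z * of_real t) powr (- a))"
proof (cases "norm z < 1")
  case True
  let ?f = "ml_beta_integrand \<alpha> \<beta> \<gamma> p b (c - b)"
  let ?c = "\<lambda>n. pochhammer a n / fact n * z ^ n"
  obtain I where I: "(\<lambda>n. ?c n * integral {0..1} (\<lambda>t. of_real t ^ n * ?f t)) sums I"
    "((\<lambda>t. (\<Sum>n. ?c n * of_real t ^ n) * ?f t) has_integral I) {0..1}"
    using has_integral_power_series_mult[OF f binomial_series_abs_summable[OF True]] by blast
  have beta: "ml_beta \<alpha> \<beta> \<gamma> p (b + of_nat n) (c - b) = integral {0..1} (\<lambda>t. of_real t ^ n * ?f t)" for n
    unfolding ml_beta_def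
  proof (rule integral_cong)
    fix t :: real assume "t \<in> {0..1}"
    \<comment> \<open>At \<open>t = 0\<close> both sides vanish, since \<open>0 powr w = 0\<close>
      for every exponent.\<close>
    have "of_real t powr (b + of_nat n - 1) = of_real t ^ n * of_real t powr (b - 1)"
      by (cases "t = 0") (auto simp: powr_add powr_diff powr_nat')
    then show "ml_beta_integrand \<alpha> \<beta> \<gamma> p (b + of_nat n) (c - b) t = of_real t ^ n * ?f t"
      by (simp add: ml_beta_integrand_def)
  qed
  have "(\<lambda>n. pochhammer a n * (ml_beta \<alpha> \<beta> \<gamma> p (b + of_nat n) (c - b) / Beta b (c - b))
                  * z ^ n / fact n) sums (I / Beta b (c - b))"
    using sums_divide[OF I(1), of "Beta b (c - b)"] by (simp add: beta mult_ac)
  moreover have "((\<lambda>t. ?f t * (1 - z * of_real t) powr (- a)) has_integral I) {0..1}"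
  proof (rule has_integral_eq[OF _ I(2)])
    fix t :: real assume t: "t \<in> {0..1}"
    then have "norm (z * of_real t) \<le> norm z * 1"
      unfolding norm_mult norm_of_real by (intro mult_left_mono) auto
    then have "norm (z * of_real t) < 1" using True by simp
    from binomial_series_sums[OF this, of a]
    show "(\<Sum>n. ?c n * of_real t ^ n) * ?f t = ?f t * (1 - z * of_real t) powr (- a)"
      by (simp add: sums_iff power_mult_distrib mult_ac)
  qed
  ultimately show ?thesis using True by (simp add: ml_hypergeom_def sums_iff integral_unique)
qed (simp add: ml_hypergeom_def)

lemma mittag_leffler3_0: "mittag_leffler3 \<alpha> \<beta> \<gamma> 0 = rGamma \<beta>"
proof -
  have "(\<Sum>n. pochhammer \<gamma> n * rGamma (\<alpha> * of_nat n + \<beta>) * 0 ^ n / fact n) =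
        (\<Sum>n\<in>{0}. pochhammer \<gamma> n * rGamma (\<alpha> * of_nat n + \<beta>) * 0 ^ n / fact n)"
    by (rule suminf_finite) auto
  then show ?thesis by (simp add: mittag_leffler3_def)
qed

text \<open>At \<open>p = 0\<close> the Mittag-Leffler factor is the constant
  \<open>rGamma \<beta>\<close>. What remains is the classical beta integrand, whose modulus on the
  open interval is the real one with exponents \<open>Re x - 1\<close> and
  \<open>Re y - 1\<close>.\<close>

lemma ml_beta_integrand_integrable_0:
  assumes x: "Re x > 0" and y: "Re y > 0"
  shows "ml_beta_integrand \<alpha> \<beta> \<gamma> 0 x y integrable_on {0..1}"
proof -
  let ?h = "\<lambda>t. of_real t powr (x - 1) * of_real (1 - t) powr (y - 1) :: complex"
  have "continuous_on {0<..<1} ?h"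
    by (intro continuous_intros) (auto simp: complex_nonpos_Reals_iff)
  then have "?h absolutely_integrable_on {0<..<1}"
  proof (rule measurable_bounded_by_integrable_imp_absolutely_integrable
      [OF continuous_imp_measurable_on_sets_lebesgue])
    show "(\<lambda>t. t powr (Re x - 1) * (1 - t) powr (Re y - 1)) integrable_on {0<..<1}"
      using integrable_Beta'[OF x y] by (simp add: integrable_on_Icc_iff_Ioo)
    show "norm (?h t) \<le> t powr (Re x - 1) * (1 - t) powr (Re y - 1)" if "t \<in> {0<..<1}" for t
      using that by (simp add: norm_mult norm_powr_real_powr del: of_real_diff)
  qed auto
  then have "?h integrable_on {0..1}"
    by (simp add: integrable_on_Icc_iff_Ioo absolutely_integrable_on_def)
  from integrable_on_mult_left[OF this, of "rGamma \<beta>"]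
  show ?thesis by (simp add: ml_beta_integrand_def[abs_def] mittag_leffler3_0)
qed

section \<open>Reflection of the unit interval and splitting of principal powers\<close>

lemma has_integral_reflect_unit_interval:
  fixes f :: "real \<Rightarrow> 'a :: real_normed_vector"
  shows "((\<lambda>t. f (1 - t)) has_integral I) {0..1} \<longleftrightarrow> (f has_integral I) {0..1}"
proof -
  have *: "((\<lambda>t. f (1 - t)) has_integral I) {0..1}" if "(f has_integral I) {0..1}" for f :: "real \<Rightarrow> 'a"
    using has_integral_affinity[of f I 0 1 "-1" 1] that by simp
  show ?thesis using *[of f] *[of "\<lambda>t. f (1 - t)"] by auto
qed

text \<open>Reflection preserves integrability in both directions, and without it both integrals
  take the same default value, so the equation holds for every \<open>f\<close>.\<close>

lemma integral_reflect_unit_interval: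
  fixes f :: "real \<Rightarrow> 'a :: banach"
  shows "integral {0..1} (\<lambda>t. f (1 - t)) = integral {0..1} f"
  by (simp add: integral_def integrable_on_def has_integral_reflect_unit_interval)

lemma ml_beta_integrand_reflect:
  "ml_beta_integrand \<alpha> \<beta> \<gamma> p x y (1 - t) = ml_beta_integrand \<alpha> \<beta> \<gamma> p y x t"
  by (simp add: ml_beta_integrand_def mult_ac)

text \<open>The imaginary parts of \<open>1 - z\<close> and \<open>1 - z s\<close> never have
  opposite signs. Their arguments therefore differ by less than \<open>pi\<close>, and the logarithm
  of the quotient is the difference of the logarithms with no multiple of
  \<open>2 pi \<i>\<close>.\<close>

lemma one_minus_scaled_powr:
  fixes a z :: complex
  assumes z: "1 - z \<notin> \<real>\<^sub>\<le>\<^sub>0" and s: "s \<in> {0..1}"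
  shows "(1 - z) powr a * ((1 - z * of_real s) / (1 - z)) powr a = (1 - z * of_real s) powr a"
proof -
  let ?u = "1 - z" and ?v = "1 - z * of_real s"
  have v: "?v \<notin> \<real>\<^sub>\<le>\<^sub>0"
  \<comment> \<open>If \<open>1 - z s\<close> were on the cut, then \<open>z\<close> would be real
    with \<open>z \<ge> z s \<ge> 1\<close>, putting \<open>1 - z\<close> on the cut too.\<close>
  proof
    assume "?v \<in> \<real>\<^sub>\<le>\<^sub>0"
    then have *: "1 \<le> Re z * s" "Im z = 0 \<or> s = 0" by (auto simp: complex_nonpos_Reals_iff)
    then have "0 < Re z * s" "s \<noteq> 0" by auto
    then have "0 < Re z" using s by (auto simp: zero_less_mult_iff)
    then have "Re z * s \<le> Re z * 1" using s by (intro mult_left_mono) auto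
    then show False using z * \<open>s \<noteq> 0\<close> by (auto simp: complex_nonpos_Reals_iff)
  qed
  have ne: "?u \<noteq> 0" "?v \<noteq> 0" using z v by auto
  have lt: "\<bar>Im (Ln ?u)\<bar> < pi" "\<bar>Im (Ln ?v)\<bar> < pi"
    using mpi_less_Im_Ln[OF ne(1)] mpi_less_Im_Ln[OF ne(2)] Im_Ln_less_pi[OF z] Im_Ln_less_pi[OF v]
    by linarith+
  have sgn: "Im ?v = s * Im ?u" by simp
  have "\<bar>Im (Ln ?v) - Im (Ln ?u)\<bar> < pi"
  proof (cases "Im ?u \<ge> 0")
    case True
    then have "Im ?v \<ge> 0" unfolding sgn using s by (intro mult_nonneg_nonneg) auto
    then have "Im (Ln ?u) \<ge> 0" "Im (Ln ?v) \<ge> 0" using True ne Im_Ln_pos_le by blast+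
    then show ?thesis using lt by linarith
  next
    case False
    then have "Im (Ln ?u) \<le> 0" using ne Im_Ln_pos_le[of ?u] lt by linarith
    moreover have "Im (Ln ?v) \<le> 0"
    \<comment> \<open>For \<open>s > 0\<close> the imaginary part of \<open>1 - z s\<close> is
      strictly negative; at \<open>s = 0\<close> the point is 1, whose logarithm is 0.\<close>
    proof (cases "s = 0")
      case False
      then have "Im ?v < 0"
        unfolding sgn using s \<open>\<not> 0 \<le> Im ?u\<close> by (intro mult_pos_neg) auto
      then show ?thesis using ne Im_Ln_pos_le[of ?v] lt by linarith
    qed simp
    ultimately show ?thesis using lt by linarith
  qed
  then have "Ln (?v / ?u) = Ln ?v - Ln ?u"
    using ne by (intro Ln_unique) (auto simp: exp_diff)
  then have "Ln ?v = Ln ?u + Ln (?v / ?u)" by simp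
  with ne show ?thesis by (simp add: powr_def exp_add distrib_left)
qed

text \<open>Reflection exchanges \<open>b\<close> and \<open>c - b\<close>, whose sum is
  \<open>c\<close>; hence the third parameter on the right is again \<open>c\<close>. The point
  \<open>z = 1\<close> is excluded separately because \<open>Arg 0 = 0\<close> would satisfy the
  bound. For \<open>p > 0\<close> integrability is a hypothesis, since the conditions on the real
  parts do not imply it.\<close>

theorem theorem3p9:
  fixes \<alpha> \<beta> \<gamma> a b c z :: complex and p :: real
  assumes "p \<ge> 0"
    and "Re \<alpha> > 0"
    and "Re c > Re b" and "Re b > 0"
    and "z \<noteq> 1" and "\<bar>Arg (1 - z)\<bar> < pi"
    and "p > 0 \<Longrightarrow> ml_beta_integrand \<alpha> \<beta> \<gamma> p b (c - b) integrable_on {0..1}"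
  shows "ml_hypergeom \<alpha> \<beta> \<gamma> p a b c z =
         (1 - z) powr (- a) * ml_hypergeom \<alpha> \<beta> \<gamma> p a (c - b) c (z / (z - 1))"
proof -
  let ?f = "ml_beta_integrand \<alpha> \<beta> \<gamma> p b (c - b)"
  let ?w = "z / (z - 1)"
  have f: "?f integrable_on {0..1}"
    using assms ml_beta_integrand_integrable_0[of b "c - b" \<alpha> \<beta> \<gamma>] by (cases "p = 0") auto
  \<comment> \<open>The exponent is left as \<open>c - (c - b)\<close> to match the Euler-type
    integral with \<open>c - b\<close> in the place of \<open>b\<close>.\<close>
  then have f': "ml_beta_integrand \<alpha> \<beta> \<gamma> p (c - b) (c - (c - b)) integrable_on {0..1}"
    using has_integral_reflect_unit_interval[of ?f]
    by (auto simp: integrable_on_def ml_beta_integrand_reflect)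
  have "1 - z \<notin> \<real>\<^sub>\<le>\<^sub>0"
    using assms(5,6) Arg_eq_pi[of "1 - z"] by (auto simp: complex_nonpos_Reals_iff complex_eq_iff)
  note powr = one_minus_scaled_powr[OF this, of _ "-a"]
  have eq: "1 - ?w * of_real (1 - s) = (1 - z * of_real s) / (1 - z)" for s
    using assms(5) by (simp add: field_simps)
  have "(1 - z) powr (- a) * integral {0..1}
          (\<lambda>t. ml_beta_integrand \<alpha> \<beta> \<gamma> p (c - b) (c - (c - b)) t * (1 - ?w * of_real t) powr (- a))
      = (1 - z) powr (- a) * integral {0..1}
          (\<lambda>s. ?f s * ((1 - z * of_real s) / (1 - z)) powr (- a))"
    by (subst integral_reflect_unit_interval[symmetric])
      (simp only: ml_beta_integrand_reflect eq, simp)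
  also have "\<dots> = integral {0..1}
      (\<lambda>s. (1 - z) powr (- a) * (?f s * ((1 - z * of_real s) / (1 - z)) powr (- a)))"
    by simp
  also have "\<dots> = integral {0..1} (\<lambda>s. ?f s * (1 - z * of_real s) powr (- a))"
    by (rule integral_cong) (subst powr[symmetric], auto)
  finally show ?thesis
    by (simp add: ml_hypergeom_eq_integral[OF f] ml_hypergeom_eq_integral[OF f'] Beta_commute mult_ac)
qed

end
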